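(* Let $X$ be a real-valued symmetric additive process. Then, for all $0\le s\le t$, the associated propagator $T_{s,t}$ is self-adjoint in $L^2(\mathbb{R})$.
   Context: An additive process is a stochastically continuous process $X=\{X(t),t\ge0\}$ with $X(0)=0$ a.s. and independent (not necessarily stationary) increments. Let $p_{s,t}$ denote the law of $X(t)-X(s)$, $0\le s\le t$. The process is called symmetric if $p_{s,t}(dy)=p_{s,t}(-dy)$ for all $0\le s\le t$, i.e. $p_{s,t}(B)=p_{s,t}(-B)$ for every Borel set $B\subset\mathbb{R}$. The propagator is $T_{s,t}f(x)=\int_{\mathbb{R}}f(x+y)\,p_{s,t}(dy)$. Self-adjointness means $\langle T_{s,t}f;g\rangle=\langle f;T_{s,t}g\rangle$ for all $f,g\in L^2(\mathbb{R})$, where $\langle\cdot;\cdot\rangle$ is the scalar product of $L^2(\mathbb{R})$. *)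

theory Defs
  imports "HOL-Probability.Probability"
begin

text \<open>Only the values \<open>X t\<close> with \<open>t \<ge> 0\<close> are meaningful; paths are not assumed to be
  regular.\<close>

locale additive_process = prob_space M
  for M :: "'w measure" and X :: "real \<Rightarrow> 'w \<Rightarrow> real" +
  assumes measurable_X: "\<And>t. 0 \<le> t \<Longrightarrow> X t \<in> borel_measurable M"
    and start_zero: "AE \<omega> in M. X 0 \<omega> = 0"
    and indep_increments: "\<And>(n::nat) (\<tau>::nat \<Rightarrow> real).
      0 \<le> \<tau> 0 \<Longrightarrow> (\<forall>i<n. \<tau> i < \<tau> (Suc i)) \<Longrightarrow>
      indep_vars (\<lambda>_. borel) (\<lambda>i \<omega>. X (\<tau> (Suc i)) \<omega> - X (\<tau> i) \<omega>) {..<n}"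
    and stoch_continuous: "\<And>t \<epsilon>. 0 \<le> t \<Longrightarrow> 0 < \<epsilon> \<Longrightarrow>
      ((\<lambda>s. prob {\<omega> \<in> space M. \<bar>X s \<omega> - X t \<omega>\<bar> > \<epsilon>}) \<longlongrightarrow> 0) (at t within {0..})"

definition increment_law :: "'w measure \<Rightarrow> (real \<Rightarrow> 'w \<Rightarrow> real) \<Rightarrow> real \<Rightarrow> real \<Rightarrow> real measure"
  where "increment_law M X s t = distr M borel (\<lambda>\<omega>. X t \<omega> - X s \<omega>)"

locale symmetric_additive_process = additive_process M X
  for M :: "'w measure" and X :: "real \<Rightarrow> 'w \<Rightarrow> real" +
  assumes symmetric_law: "\<And>s t B. 0 \<le> s \<Longrightarrow> s \<le> t \<Longrightarrow> B \<in> sets borel \<Longrightarrow>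
      measure (increment_law M X s t) B = measure (increment_law M X s t) (uminus ` B)"

text \<open>Elements of the complex space \<open>L\<^sup>2(\<real>)\<close> are represented by Borel measurable functions,
  to be read up to equality almost everywhere. Every class has a Borel representative, and Borel
  measurability makes \<open>\<lambda>y. f (x + y)\<close> measurable for an arbitrary Borel law, also one
  with atoms or a singular part.\<close>

definition L2 :: "(real \<Rightarrow> complex) set"
  where "L2 = {f \<in> borel_measurable lborel. integrable lborel (\<lambda>x. (norm (f x))\<^sup>2)}"

definition L2_inner :: "(real \<Rightarrow> complex) \<Rightarrow> (real \<Rightarrow> complex) \<Rightarrow> complex"
  where "L2_inner f g = (LINT x|lborel. f x * cnj (g x))"

text \<open>For \<open>f \<in> L\<^sup>2\<close> the integral exists for almost every \<open>x\<close>; at the exceptional points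
  the Bochner integral has the conventional value 0.\<close>

definition propagator ::
    "'w measure \<Rightarrow> (real \<Rightarrow> 'w \<Rightarrow> real) \<Rightarrow> real \<Rightarrow> real \<Rightarrow> (real \<Rightarrow> complex) \<Rightarrow> real \<Rightarrow> complex"
  where "propagator M X s t f x = (LINT y|increment_law M X s t. f (x + y))"

text \<open>The first two conjuncts say that \<open>A\<close> induces a map of the space of equivalence classes
  into itself; without the first one the scalar products in the third could be meaningless.\<close>

definition self_adjoint_L2 :: "((real \<Rightarrow> complex) \<Rightarrow> real \<Rightarrow> complex) \<Rightarrow> bool"
  where "self_adjoint_L2 A \<longleftrightarrow>
    (\<forall>f\<in>L2. A f \<in> L2) \<and>
    (\<forall>f\<in>L2. \<forall>g\<in>L2. (AE x in lborel. f x = g x) \<longrightarrow> (AE x in lborel. A f x = A g x)) \<and>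
    (\<forall>f\<in>L2. \<forall>g\<in>L2. L2_inner (A f) g = L2_inner f (A g))"

end

theory Submission
  imports Defs
begin

text \<open>For a probability law \<open>P\<close> on the line, the operator
  \<open>f \<mapsto> (\<lambda>x. \<integral>y. f (x + y) \<partial>P)\<close> is a contraction of \<open>L\<^sup>2\<close> by the Cauchy--Schwarz inequality,
  Fubini's theorem and the translation invariance of Lebesgue measure. Fubini and the substitution
  \<open>x \<mapsto> x - y\<close> identify its adjoint as the operator of the reflected law, which is \<open>P\<close> itself
  when \<open>P\<close> is symmetric.\<close>

text \<open>By translation invariance the \<open>L1\<close> norm of
  \<open>x \<mapsto> h (x + y)\<close> is the same for every \<open>y\<close>. Its integral over the
  probability law \<open>P\<close> is therefore finite, which is what Fubini's criterion asks
  for.\<close>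

lemma integrable_shift_pair:
  fixes h :: "real \<Rightarrow> 'b::{banach, second_countable_topology}"
  assumes "prob_space P" "sets P = sets borel" and h: "integrable lborel h"
  shows "integrable (P \<Otimes>\<^sub>M lborel) (\<lambda>(y, x). h (x + y))"
proof -
  interpret P: prob_space P by fact
  interpret pair_sigma_finite P lborel ..
  note [measurable_cong] = assms(2)
  have [measurable]: "h \<in> borel_measurable borel" using h by auto
  have shift: "integrable lborel (\<lambda>x. h (x + y))" for y
    using lborel_integrable_real_affine[OF h, of 1 y] by (simp add: add.commute)
  have "(\<integral>x. norm (h (x + y)) \<partial>lborel) = (\<integral>x. norm (h x) \<partial>lborel)" for y
    using lborel_integral_real_affine[of 1 "\<lambda>x. norm (h x)" y] by (simp add: add.commute)
  then show ?thesis
    by (intro Fubini_integrable) (auto simp: shift)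
qed

text \<open>For each fixed \<open>y\<close> the exceptional set is a translate of a null set; Fubini
  then exchanges the two almost-everywhere quantifiers. Hence \<open>P\<close> may have atoms or a
  singular part.\<close>

lemma AE_shift:
  fixes f g :: "real \<Rightarrow> 'b::{second_countable_topology, t2_space}"
  assumes "prob_space P" "sets P = sets borel"
    and [measurable]: "f \<in> borel_measurable borel" "g \<in> borel_measurable borel"
    and eq: "AE x in lborel. f x = g x"
  shows "AE x in lborel. AE y in P. f (x + y) = g (x + y)"
proof -
  interpret P: prob_space P by fact
  interpret pair_sigma_finite P lborel ..
  note [measurable_cong] = assms(2)
  have "AE x in lborel. f (x + y) = g (x + y)" for y
  proof -
    have "AE x in distr lborel borel ((+) y). f x = g x"
      using eq by (simp only: lborel_distr_plus)
    then show ?thesis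
      by (subst (asm) AE_distr_iff) (auto simp: add.commute)
  qed
  then have "AE y in P. AE x in lborel. f (x + y) = g (x + y)"
    by simp
  \<comment> \<open>Exchanging the quantifiers requires joint measurability of the exceptional set,
    which rests on the Borel measurability of \<open>f\<close> and \<open>g\<close>.\<close>
  moreover have "{z \<in> space (P \<Otimes>\<^sub>M lborel). f (snd z + fst z) = g (snd z + fst z)} \<in> sets (P \<Otimes>\<^sub>M lborel)"
    by measurable
  ultimately show ?thesis
    using AE_commute[of "\<lambda>y x. f (x + y) = g (x + y)"] by blast
qed

text \<open>This is Cauchy--Schwarz against the constant 1, obtained from the nonnegativity of the
  variance of \<open>norm (f x)\<close>.\<close>

lemma (in prob_space) norm_integral_square_le:
  fixes f :: "'a \<Rightarrow> 'b::{banach, second_countable_topology}"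
  assumes [measurable]: "f \<in> borel_measurable M" and sq: "integrable M (\<lambda>x. (norm (f x))\<^sup>2)"
  shows "(norm (\<integral>x. f x \<partial>M))\<^sup>2 \<le> (\<integral>x. (norm (f x))\<^sup>2 \<partial>M)"
proof -
  have "integrable M (\<lambda>x. norm (f x))"
    using sq by (rule square_integrable_imp_integrable[rotated]) measurable
  then have "variance (\<lambda>x. norm (f x)) = (\<integral>x. (norm (f x))\<^sup>2 \<partial>M) - (\<integral>x. norm (f x) \<partial>M)\<^sup>2"
    using sq by (intro variance_eq)
  moreover have "0 \<le> variance (\<lambda>x. norm (f x))"
    by (rule variance_positive)
  moreover have "(norm (\<integral>x. f x \<partial>M))\<^sup>2 \<le> (\<integral>x. norm (f x) \<partial>M)\<^sup>2"
    by (intro power_mono integral_norm_bound) auto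
  ultimately show ?thesis
    by linarith
qed

lemma L2_average_shift:
  assumes "prob_space P" "sets P = sets borel" and f: "f \<in> L2"
  shows "(\<lambda>x. \<integral>y. f (x + y) \<partial>P) \<in> L2"
proof -
  interpret P: prob_space P by fact
  interpret pair_sigma_finite P lborel ..
  note [measurable_cong] = assms(2)
  have [measurable]: "f \<in> borel_measurable borel"
    and sq: "integrable lborel (\<lambda>x. (norm (f x))\<^sup>2)"
    using f by (auto simp: L2_def)
  have int: "integrable (P \<Otimes>\<^sub>M lborel) (\<lambda>(y, x). (norm (f (x + y)))\<^sup>2)"
    using integrable_shift_pair[OF assms(1,2) sq] .
  have "integrable lborel (\<lambda>x. (norm (\<integral>y. f (x + y) \<partial>P))\<^sup>2)"
  proof (rule Bochner_Integration.integrable_bound)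
    show "integrable lborel (\<lambda>x. \<integral>y. (norm (f (x + y)))\<^sup>2 \<partial>P)"
      using integrable_snd[OF int] .
    \<comment> \<open>Where \<open>y \<mapsto> (norm (f (x + y)))\<^sup>2\<close> is not integrable,
      the right-hand side is 0 by convention and the bound may fail; Fubini makes these
      \<open>x\<close> a null set.\<close>
    show "AE x in lborel. norm ((norm (\<integral>y. f (x + y) \<partial>P))\<^sup>2)
        \<le> norm (\<integral>y. (norm (f (x + y)))\<^sup>2 \<partial>P)"
      using AE_integrable_snd[OF int]
    proof eventually_elim
      case (elim x)
      then show ?case
        using P.norm_integral_square_le[of "\<lambda>y. f (x + y)"] by simp
    qed
  qed measurable
  then show ?thesis
    by (simp add: L2_def)
qed

lemma borel_measurable_cnj [measurable]: "cnj \<in> borel_measurable borel"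
  by (intro borel_measurable_continuous_onI continuous_intros)

text \<open>Fubini applies because the integrand is dominated by
  \<open>(norm (f (x + y)))\<^sup>2 + (norm (g x))\<^sup>2\<close>, which is integrable on the
  product. The second summand is constant in \<open>y\<close>, so finiteness of \<open>P\<close>
  suffices for it.\<close>

lemma L2_inner_average_shift:
  assumes "prob_space P" "sets P = sets borel" and f: "f \<in> L2" and g: "g \<in> L2"
  shows "L2_inner (\<lambda>x. \<integral>y. f (x + y) \<partial>P) g = (\<integral>y. (\<integral>x. f (x + y) * cnj (g x) \<partial>lborel) \<partial>P)"
proof -
  interpret P: prob_space P by fact
  interpret pair_sigma_finite P lborel ..
  note [measurable_cong] = assms(2)
  have [measurable]: "f \<in> borel_measurable borel" "g \<in> borel_measurable borel"
    and sqf: "integrable lborel (\<lambda>x. (norm (f x))\<^sup>2)"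
    and sqg: "integrable lborel (\<lambda>x. (norm (g x))\<^sup>2)"
    using f g by (auto simp: L2_def)
  have bound: "norm a * norm b \<le> (norm a)\<^sup>2 + (norm b)\<^sup>2" for a b :: complex
    using sum_squares_bound[of "norm a" "norm b"] mult_nonneg_nonneg[OF norm_ge_zero norm_ge_zero, of a b]
    by linarith
  have "integrable (P \<Otimes>\<^sub>M lborel) (\<lambda>(y, x). (norm (g x))\<^sup>2)"
    using sqg by (intro Fubini_integrable) auto
  from Bochner_Integration.integrable_add[OF integrable_shift_pair[OF assms(1,2) sqf] this]
  have "integrable (P \<Otimes>\<^sub>M lborel) (\<lambda>(y, x). f (x + y) * cnj (g x))"
    by (rule Bochner_Integration.integrable_bound) (auto simp: norm_mult bound)
  from Fubini_integral[OF this]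
  show ?thesis
    by (simp add: L2_inner_def)
qed

lemma self_adjoint_average_shift:
  assumes "prob_space P" "sets P = sets borel" and sym: "distr P borel uminus = P"
  shows "self_adjoint_L2 (\<lambda>f x. \<integral>y. f (x + y) \<partial>P)"
  unfolding self_adjoint_L2_def
proof (intro conjI ballI impI)
  note [measurable_cong] = assms(2)
  interpret P: prob_space P by fact
  fix f assume f: "f \<in> L2"
  show "(\<lambda>x. \<integral>y. f (x + y) \<partial>P) \<in> L2"
    using assms(1,2) f by (rule L2_average_shift)
  fix g assume g: "g \<in> L2"
  have [measurable]: "f \<in> borel_measurable borel" "g \<in> borel_measurable borel"
    using f g by (auto simp: L2_def)
  show "AE x in lborel. (\<integral>y. f (x + y) \<partial>P) = (\<integral>y. g (x + y) \<partial>P)"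
    if eq: "AE x in lborel. f x = g x"
    using AE_shift[OF assms(1,2) _ _ eq]
    by (auto elim!: eventually_mono intro!: integral_cong_AE)
  have "L2_inner (\<lambda>x. \<integral>y. f (x + y) \<partial>P) g = (\<integral>y. (\<integral>x. f (x + y) * cnj (g x) \<partial>lborel) \<partial>P)"
    by (rule L2_inner_average_shift) fact+
  \<comment> \<open>The substitution \<open>x \<mapsto> x - y\<close> moves the shift from
    \<open>f\<close> to \<open>g\<close> and reverses its sign.\<close>
  also have "\<dots> = (\<integral>y. (\<integral>x. f x * cnj (g (x + - y)) \<partial>lborel) \<partial>P)"
    using lborel_integral_real_affine[of 1 "\<lambda>x. f (x + y) * cnj (g x)" "- y" for y]
    by (simp add: add.commute)
  \<comment> \<open>The sign is absorbed into the reflected law, which \<open>sym\<close> replaces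
    by \<open>P\<close> in the next step.\<close>
  also have "\<dots> = (\<integral>y. (\<integral>x. f x * cnj (g (x + y)) \<partial>lborel) \<partial>distr P borel uminus)"
    by (subst integral_distr) auto
  \<comment> \<open>Conjugating brings the inner integral into the form of
    \<open>L2_inner_average_shift\<close> with \<open>f\<close> and \<open>g\<close>
    exchanged.\<close>
  also have "\<dots> = (\<integral>y. cnj (\<integral>x. g (x + y) * cnj (f x) \<partial>lborel) \<partial>P)"
    by (simp only: sym Bochner_Integration.integral_cnj[symmetric] complex_cnj_mult complex_cnj_cnj mult.commute)
  also have "\<dots> = cnj (L2_inner (\<lambda>x. \<integral>y. g (x + y) \<partial>P) f)"
    unfolding L2_inner_average_shift[OF assms(1,2) g f] by simp
  also have "\<dots> = L2_inner f (\<lambda>x. \<integral>y. g (x + y) \<partial>P)"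
    by (simp only: L2_inner_def Bochner_Integration.integral_cnj[symmetric] complex_cnj_mult complex_cnj_cnj mult.commute)
  finally show "L2_inner (\<lambda>x. \<integral>y. f (x + y) \<partial>P) g = L2_inner f (\<lambda>x. \<integral>y. g (x + y) \<partial>P)" .
qed

theorem lemma2:
  fixes M :: "'w measure" and X :: "real \<Rightarrow> 'w \<Rightarrow> real"
  assumes "symmetric_additive_process M X"
  shows "\<forall>s t. 0 \<le> s \<and> s \<le> t \<longrightarrow> self_adjoint_L2 (propagator M X s t)"
proof (intro allI impI, elim conjE)
  interpret symmetric_additive_process M X by fact
  fix s t :: real assume st: "0 \<le> s" "s \<le> t"
  let ?P = "increment_law M X s t"
  have [measurable]: "X s \<in> borel_measurable M" "X t \<in> borel_measurable M"
    using st by (auto intro: measurable_X)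
  have sets: "sets ?P = sets borel"
    by (simp add: increment_law_def)
  note [measurable_cong] = sets
  have prob: "prob_space ?P"
    unfolding increment_law_def by (rule prob_space_distr) measurable
  then interpret P: prob_space ?P .
  have "distr ?P borel uminus = ?P"
  proof (rule measure_eqI)
    fix B assume "B \<in> sets (distr ?P borel uminus)"
    then have B: "B \<in> sets borel" by simp
    have "emeasure (distr ?P borel uminus) B = emeasure ?P (uminus -` B)"
      using B sets_eq_imp_space_eq[OF sets] by (subst emeasure_distr) auto
    \<comment> \<open>Negation is an involution, so the preimage in the pushforward is the image in
      \<open>symmetric_law\<close>.\<close>
    also have "uminus -` B = uminus ` B"
      by (force simp: image_iff)
    finally show "emeasure (distr ?P borel uminus) B = emeasure ?P B"
      using symmetric_law[OF st B] by (simp add: P.emeasure_eq_measure)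
  qed (simp add: sets)
  from self_adjoint_average_shift[OF prob sets this]
  show "self_adjoint_L2 (propagator M X s t)"
    by (simp add: propagator_def[abs_def])
qed

end
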